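(* Let $(L,\mu_1,\mu_2,\delta_1,\delta_2)$ be a compatible AssDer pair. For $x,y\in L$ define $$[x,y]_1=\mu_1(x,y)-\mu_1(y,x),\qquad [x,y]_2=\mu_2(x,y)-\mu_2(y,x).$$ Then $(L,[\cdot,\cdot]_1,[\cdot,\cdot]_2,\delta_1,\delta_2)$ is a compatible LieDer pair.
   Context: All vector spaces are over a field $\mathbb{K}$ of characteristic $0$. An AssDer pair $(L,\mu,\delta)$ is an associative algebra $(L,\mu)$ with a linear map $\delta:L\to L$ such that $\delta\mu(x,y)=\mu(\delta x,y)+\mu(x,\delta y)$. A compatible AssDer pair $(L,\mu_1,\mu_2,\delta_1,\delta_2)$ consists of two AssDer pairs $(L,\mu_1,\delta_1)$, $(L,\mu_2,\delta_2)$ on the same vector space such that for all $x,y,z\in L$: (1) $\mu_2(\mu_1(x,y),z)+\mu_1(\mu_2(x,y),z)=\mu_1(x,\mu_2(y,z))+\mu_2(x,\mu_1(y,z))$; (2) $\delta_1(\mu_2(x,y))+\delta_2(\mu_1(x,y))=\mu_2(\delta_1x,y)+\mu_2(x,\delta_1y)+\mu_1(\delta_2x,y)+\mu_1(x,\delta_2y)$. A LieDer pair $(L,[\cdot,\cdot],\delta)$ is a Lie algebra with a linear map $\delta$ such that $\delta[x,y]=[\delta x,y]+[x,\delta y]$. A compatible LieDer pair $(L,[\cdot,\cdot]_1,[\cdot,\cdot]_2,\delta_1,\delta_2)$ consists of two LieDer pairs $(L,[\cdot,\cdot]_1,\delta_1)$, $(L,[\cdot,\cdot]_2,\delta_2)$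 on the same vector space such that for all $x,y,z\in L$ (with $\circlearrowleft_{x,y,z}$ the sum over cyclic permutations of $x,y,z$): (1) $\circlearrowleft_{x,y,z}[x,[y,z]_1]_2+\circlearrowleft_{x,y,z}[x,[y,z]_2]_1=0$; (2) $\delta_1[x,y]_2+\delta_2[x,y]_1=[\delta_1x,y]_2+[x,\delta_1y]_2+[\delta_2x,y]_1+[x,\delta_2y]_1$. *)

theory Defs
  imports Complex_Main
begin

text \<open>
  Algebras over an arbitrary field, on a vector space given by its scalar multiplication; the
  library's bilinearity predicate in HOL-Analysis covers only real scalars.
\<close>

locale bilinear_product = vector_space scale
  for scale :: "'k::field \<Rightarrow> 'v::ab_group_add \<Rightarrow> 'v" +
  fixes prd :: "'v \<Rightarrow> 'v \<Rightarrow> 'v"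
  assumes linear_left: "\<And>y. Vector_Spaces.linear scale scale (\<lambda>x. prd x y)"
    and linear_right: "\<And>x. Vector_Spaces.linear scale scale (\<lambda>y. prd x y)"

locale assoc_algebra = bilinear_product scale \<mu>
  for scale :: "'k::field \<Rightarrow> 'v::ab_group_add \<Rightarrow> 'v" and \<mu> +
  assumes assoc: "\<And>x y z. \<mu> (\<mu> x y) z = \<mu> x (\<mu> y z)"

definition cyclic_sum :: "('v \<Rightarrow> 'v \<Rightarrow> 'v \<Rightarrow> 'v::ab_group_add) \<Rightarrow> 'v \<Rightarrow> 'v \<Rightarrow> 'v \<Rightarrow> 'v" where
  "cyclic_sum f x y z = f x y z + f y z x + f z x y"

locale lie_algebra = bilinear_product scale br
  for scale :: "'k::field \<Rightarrow> 'v::ab_group_add \<Rightarrow> 'v" and br +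
  assumes alternating: "\<And>x. br x x = 0"
    and jacobi: "\<And>x y z. cyclic_sum (\<lambda>x y z. br x (br y z)) x y z = 0"

locale assder_pair = assoc_algebra scale \<mu>
  for scale :: "'k::field \<Rightarrow> 'v::ab_group_add \<Rightarrow> 'v" and \<mu> +
  fixes \<delta> :: "'v \<Rightarrow> 'v"
  assumes linear_der: "Vector_Spaces.linear scale scale \<delta>"
    and derivation: "\<And>x y. \<delta> (\<mu> x y) = \<mu> (\<delta> x) y + \<mu> x (\<delta> y)"

locale lieder_pair = lie_algebra scale br
  for scale :: "'k::field \<Rightarrow> 'v::ab_group_add \<Rightarrow> 'v" and br +
  fixes \<delta> :: "'v \<Rightarrow> 'v"
  assumes linear_der: "Vector_Spaces.linear scale scale \<delta>"
    and derivation: "\<And>x y. \<delta> (br x y) = br (\<delta> x) y + br x (\<delta> y)"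

locale compatible_assder_pair =
  P1: assder_pair scale \<mu>1 \<delta>1 + P2: assder_pair scale \<mu>2 \<delta>2
  for scale :: "'k::field \<Rightarrow> 'v::ab_group_add \<Rightarrow> 'v" and \<mu>1 \<mu>2 \<delta>1 \<delta>2 +
  assumes compat_product:
      "\<And>x y z. \<mu>2 (\<mu>1 x y) z + \<mu>1 (\<mu>2 x y) z = \<mu>1 x (\<mu>2 y z) + \<mu>2 x (\<mu>1 y z)"
    and compat_derivation:
      "\<And>x y. \<delta>1 (\<mu>2 x y) + \<delta>2 (\<mu>1 x y) =
        \<mu>2 (\<delta>1 x) y + \<mu>2 x (\<delta>1 y) + \<mu>1 (\<delta>2 x) y + \<mu>1 x (\<delta>2 y)"

locale compatible_lieder_pair =
  P1: lieder_pair scale br1 \<delta>1 + P2: lieder_pair scale br2 \<delta>2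
  for scale :: "'k::field \<Rightarrow> 'v::ab_group_add \<Rightarrow> 'v" and br1 br2 \<delta>1 \<delta>2 +
  assumes compat_bracket:
      "\<And>x y z. cyclic_sum (\<lambda>x y z. br2 x (br1 y z)) x y z
        + cyclic_sum (\<lambda>x y z. br1 x (br2 y z)) x y z = 0"
    and compat_derivation:
      "\<And>x y. \<delta>1 (br2 x y) + \<delta>2 (br1 x y) =
        br2 (\<delta>1 x) y + br2 x (\<delta>1 y) + br1 (\<delta>2 x) y + br1 x (\<delta>2 y)"

end

theory Submission
  imports Defs
begin

text \<open>Every bracket axiom is the antisymmetrization of an axiom for the products. Expanding a
  double commutator by bilinearity and summing cyclically gives the signed sum of the associator
  over all permutations of the arguments. This proves Jacobi for each product
  (\<open>lie_algebra_commutator\<close>). In the mixed identity the associator is replaced by the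
  difference of the two sides of \<open>compat_product\<close>, which also vanishes. The Leibniz
  rules, plain (\<open>lieder_pair_commutator\<close>) and mixed, follow by subtracting the instance
  with the arguments exchanged.\<close>

context bilinear_product
begin

lemma prd_diff_left: "prd (x - y) z = prd x z - prd y z"
proof -
  interpret Vector_Spaces.linear scale scale "\<lambda>x. prd x z" by (rule linear_left)
  show ?thesis by (rule diff)
qed

lemma prd_diff_right: "prd x (y - z) = prd x y - prd x z"
proof -
  interpret Vector_Spaces.linear scale scale "prd x" using linear_right by simp
  show ?thesis by (rule diff)
qed

lemma bilinear_product_commutator: "bilinear_product scale (\<lambda>x y. prd x y - prd y x)"
proof -
  interpret vector_space_pair scale scale ..
  show ?thesis
    by (intro bilinear_product.intro bilinear_product_axioms.intro vector_space_axioms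
        linear_compose_sub linear_left linear_right)
qed

end

text \<open>In the cyclic sum each of the six orderings occurs once in each nesting, with opposite
  signs, so the twelve terms cancel in pairs once \<open>assoc\<close> nests them all to the
  right.\<close>

lemma (in assoc_algebra) lie_algebra_commutator:
  "lie_algebra scale (\<lambda>x y. \<mu> x y - \<mu> y x)"
proof (intro lie_algebra.intro lie_algebra_axioms.intro)
  show "bilinear_product scale (\<lambda>x y. \<mu> x y - \<mu> y x)"
    by (rule bilinear_product_commutator)
qed (simp_all add: cyclic_sum_def prd_diff_left prd_diff_right assoc)

lemma (in assder_pair) lieder_pair_commutator:
  "lieder_pair scale (\<lambda>x y. \<mu> x y - \<mu> y x) \<delta>"
proof (intro lieder_pair.intro lieder_pair_axioms.intro)
  interpret \<delta>: Vector_Spaces.linear scale scale \<delta> by (rule linear_der)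
  show "\<delta> (\<mu> x y - \<mu> y x) = \<mu> (\<delta> x) y - \<mu> y (\<delta> x) + (\<mu> x (\<delta> y) - \<mu> (\<delta> y) x)" for x y
    by (simp add: \<delta>.diff derivation)
qed (rule lie_algebra_commutator linear_der)+

theorem proposition4p5:
  fixes scale :: "'k::field_char_0 \<Rightarrow> 'v::ab_group_add \<Rightarrow> 'v"
    and \<mu>1 \<mu>2 :: "'v \<Rightarrow> 'v \<Rightarrow> 'v"
    and \<delta>1 \<delta>2 :: "'v \<Rightarrow> 'v"
  assumes "compatible_assder_pair scale \<mu>1 \<mu>2 \<delta>1 \<delta>2"
  shows "compatible_lieder_pair scale
    (\<lambda>x y. \<mu>1 x y - \<mu>1 y x) (\<lambda>x y. \<mu>2 x y - \<mu>2 y x) \<delta>1 \<delta>2"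
proof -
  interpret compatible_assder_pair scale \<mu>1 \<mu>2 \<delta>1 \<delta>2 by (rule assms)
  interpret \<delta>1: Vector_Spaces.linear scale scale \<delta>1 by (rule P1.linear_der)
  interpret \<delta>2: Vector_Spaces.linear scale scale \<delta>2 by (rule P2.linear_der)
  let ?br1 = "\<lambda>x y. \<mu>1 x y - \<mu>1 y x" and ?br2 = "\<lambda>x y. \<mu>2 x y - \<mu>2 y x"
  show ?thesis
  proof (intro compatible_lieder_pair.intro compatible_lieder_pair_axioms.intro)
    \<comment> \<open>Solving for one left-nested term gives a terminating rewrite rule; the
      remaining \<open>\<mu>1 (\<mu>2 x y) z\<close> terms then cancel among themselves.\<close>
    have swap: "\<mu>2 (\<mu>1 x y) z = \<mu>1 x (\<mu>2 y z) + \<mu>2 x (\<mu>1 y z) - \<mu>1 (\<mu>2 x y) z" for x y z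
      using compat_product[of x y z] by (simp add: eq_diff_eq)
    show "cyclic_sum (\<lambda>x y z. ?br2 x (?br1 y z)) x y z
        + cyclic_sum (\<lambda>x y z. ?br1 x (?br2 y z)) x y z = 0" for x y z
      by (simp add: cyclic_sum_def P1.prd_diff_left P1.prd_diff_right
          P2.prd_diff_left P2.prd_diff_right swap)
    show "\<delta>1 (?br2 x y) + \<delta>2 (?br1 x y) =
        ?br2 (\<delta>1 x) y + ?br2 x (\<delta>1 y) + ?br1 (\<delta>2 x) y + ?br1 x (\<delta>2 y)" for x y
    proof -
      \<comment> \<open>The terms are regrouped by argument order, since
        \<open>compat_derivation\<close> rewrites only the sum of both mixed terms, not either one
        alone.\<close>
      have "\<delta>1 (?br2 x y) + \<delta>2 (?br1 x y) =
          (\<delta>1 (\<mu>2 x y) + \<delta>2 (\<mu>1 x y)) - (\<delta>1 (\<mu>2 y x) + \<delta>2 (\<mu>1 y x))"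
        by (simp add: \<delta>1.diff \<delta>2.diff)
      then show ?thesis
        by (simp add: compat_derivation)
    qed
  qed (rule P1.lieder_pair_commutator P2.lieder_pair_commutator)+
qed

end
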